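(* Let $G$ be a finite group. Then $\mathcal{RP}(G)$ is claw-free if and only if $G\cong\mathbb Z_n$, $n=2,3,4$.
   Context: For a group $G$, the reduced power graph $\mathcal{RP}(G)$ is the simple graph with vertex set $G$ in which $u,v$ are adjacent if and only if $\langle v\rangle\subset\langle u\rangle$ or $\langle u\rangle\subset\langle v\rangle$, where $\subset$ means proper inclusion. A graph is claw-free if it has no induced subgraph isomorphic to $K_{1,3}$.
   Formalization: The group G is additionally assumed to be non-trivial, since the trivial group has a one-vertex, hence claw-free, reduced power graph but is not isomorphic to Z_2, Z_3 or Z_4. *)

theory Defs
  imports "HOL-Algebra.Elementary_Groups" "Graph_Theory.Kuratowski"
begin

text \<open>
  Simple graphs are rendered as in \<^theory>\<open>Graph_Theory.Digraph\<close>: an undirected edge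
  \<open>{u, v}\<close> is the pair of opposite arcs \<open>(u, v)\<close> and \<open>(v, u)\<close>.
\<close>

definition reduced_power_graph :: "('a, 'b) monoid_scheme \<Rightarrow> 'a pair_pre_digraph" where
  "reduced_power_graph G =
     \<lparr> pverts = carrier G,
       parcs = {(u, v). u \<in> carrier G \<and> v \<in> carrier G \<and>
                  (generate G {v} \<subset> generate G {u} \<or> generate G {u} \<subset> generate G {v})} \<rparr>"

lemma reduced_power_graph_graph:
  assumes "finite (carrier G)"
  shows "graph (with_proj (reduced_power_graph G))"
proof -
  have "finite (parcs (reduced_power_graph G))"
    by (rule finite_subset[of _ "carrier G \<times> carrier G"])
       (use assms in \<open>auto simp: reduced_power_graph_def\<close>)
  then interpret pair_graph "reduced_power_graph G"
    using assms
    by unfold_locales (auto simp: reduced_power_graph_def symmetric_def intro!: symI)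
  show ?thesis by unfold_locales
qed

text \<open>
  The predicate \<open>K\<^bsub>1,3\<^esub>\<close> holds of every graph isomorphic to the complete bipartite graph with
  parts of sizes 1 and 3, so no separate isomorphism is needed.
\<close>

definition claw_free :: "('a, 'b) pre_digraph \<Rightarrow> bool" where
  "claw_free \<Gamma> \<longleftrightarrow> \<not> (\<exists>H. induced_subgraph H \<Gamma> \<and> K\<^bsub>1,3\<^esub> H)"

end

theory Submission
  imports Defs "HOL-Algebra.Multiplicative_Group"
begin

text \<open>
  The identity is adjacent to every other vertex, so three pairwise non-adjacent elements other
  than the identity span a claw centred at the identity.  Two facts suffice to recognise
  non-adjacency: cyclic subgroups of the same finite order are never properly included in one
  another, and \<open>\<langle>u\<rangle> \<subseteq> \<langle>v\<rangle>\<close> forces \<open>ord u\<close> to divide \<open>ord v\<close>.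

  If \<open>x\<close> has order \<open>m \<ge> 5\<close>, its powers already contain an independent triple
  (\<open>not_claw_free_if_ord_ge_5\<close>).  Otherwise let \<open>x\<close> have maximal order \<open>m\<close>, so that \<open>2 \<le> m \<le> 4\<close>.
  An element \<open>y\<close> outside \<open>\<langle>x\<rangle>\<close> is not adjacent to any generator of \<open>\<langle>x\<rangle>\<close>, so \<open>x\<close>, \<open>x\<inverse>\<close>, \<open>y\<close> is an
  independent triple if \<open>m \<ge> 3\<close>, while for \<open>m = 2\<close> the involutions \<open>x\<close>, \<open>y\<close>, \<open>x y\<close> form one
  (\<open>outside_maximal_imp_not_claw_free\<close>).  Hence claw-freeness makes \<open>G\<close> cyclic of order at most 4.

  For the converse, a claw has four vertices, so only the cyclic group of order 4 is in question.
  There both the identity and the involution are adjacent to all other vertices, and three of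
  the four vertices cannot avoid both.
\<close>

section \<open>Claws in symmetric graphs given by pairs\<close>

lemma arcs_ends_induced_with_proj:
  assumes "induced_subgraph H (with_proj P)"
  shows "arcs_ends H = parcs P \<inter> verts H \<times> verts H"
proof -
  have "tail H = fst" "head H = snd"
    using assms by (simp_all add: induced_subgraph_def subgraph_def compatible_def)
  then have "arcs_ends H = arcs H"
    by (simp add: arcs_ends_def arc_to_ends_def)
  also have "arcs H = {e \<in> parcs P. fst e \<in> verts H \<and> snd e \<in> verts H}"
    using assms unfolding induced_subgraph_def by simp
  also have "\<dots> = parcs P \<inter> verts H \<times> verts H"
    by (auto simp: mem_Times_iff)
  finally show ?thesis .
qed

text \<open>
  The centre is \<open>c\<close> and the leaves are \<open>u\<close>, \<open>v\<close>, \<open>w\<close>; the centre differs from the leaves because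
  the graph has no loops.
\<close>

lemma (in pair_graph) claw_free_iff:
  "claw_free (with_proj G) \<longleftrightarrow>
     \<not> (\<exists>c u v w. u \<noteq> v \<and> u \<noteq> w \<and> v \<noteq> w \<and> {(c, u), (c, v), (c, w)} \<subseteq> parcs G \<and>
         (u, v) \<notin> parcs G \<and> (u, w) \<notin> parcs G \<and> (v, w) \<notin> parcs G)"
    (is "_ \<longleftrightarrow> \<not> ?claw")
proof -
  have "(\<exists>H. induced_subgraph H (with_proj G) \<and> K\<^bsub>1,3\<^esub> H) \<longleftrightarrow> ?claw"
  proof
    assume "\<exists>H. induced_subgraph H (with_proj G) \<and> K\<^bsub>1,3\<^esub> H"
    then obtain H U V where H: "induced_subgraph H (with_proj G)"
      and UV: "verts H = U \<union> V" "U \<inter> V = {}" "card U = 1" "card V = 3"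
        "arcs_ends H = U \<times> V \<union> V \<times> U"
      unfolding complete_bipartite_digraph_def by blast
    obtain c where c: "U = {c}" using UV(3) by (rule card_1_singletonE)
    obtain u v w where V: "V = {u, v, w}" "u \<noteq> v" "u \<noteq> w" "v \<noteq> w"
      using UV(4) by (auto simp: card_3_iff)
    have edge: "(a, b) \<in> parcs G \<longleftrightarrow> (a, b) \<in> U \<times> V \<union> V \<times> U"
      if "a \<in> U \<union> V" "b \<in> U \<union> V" for a b
      using arcs_ends_induced_with_proj[OF H] UV(1,5) that by auto
    have "u \<noteq> c" "v \<noteq> c" "w \<noteq> c" using UV(2) c V(1) by auto
    then have "{(c, u), (c, v), (c, w)} \<subseteq> parcs G \<and>
        (u, v) \<notin> parcs G \<and> (u, w) \<notin> parcs G \<and> (v, w) \<notin> parcs G"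
      using edge c V(1) by simp
    with V show ?claw by blast
  next
    assume ?claw
    then obtain c u v w where d: "u \<noteq> v" "u \<noteq> w" "v \<noteq> w"
      and e: "(c, u) \<in> parcs G" "(c, v) \<in> parcs G" "(c, w) \<in> parcs G"
      and n: "(u, v) \<notin> parcs G" "(u, w) \<notin> parcs G" "(v, w) \<notin> parcs G"
      by auto
    have sym: "(b, a) \<in> parcs G" if "(a, b) \<in> parcs G" for a b
      using that arcs_symmetric by blast
    have loop: "(a, a) \<notin> parcs G" for a
      using no_loops by fastforce
    let ?H = "with_proj G \<restriction> {c, u, v, w}"
    have ind: "induced_subgraph ?H (with_proj G)"
      using e by (intro induced_induce) (auto dest: arc_fst_in_verts arc_snd_in_verts)
    have "c \<noteq> u" "c \<noteq> v" "c \<noteq> w" using e loop by auto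
    moreover have "arcs_ends ?H = {c} \<times> {u, v, w} \<union> {u, v, w} \<times> {c}"
      unfolding arcs_ends_induced_with_proj[OF ind] using e n sym loop by auto
    moreover have "graph ?H"
    proof -
      interpret H: digraph ?H using ind by (rule digraphI_induced)
      interpret H: sym_digraph ?H using ind by (rule induced_graph_imp_graph)
      show ?thesis by unfold_locales
    qed
    ultimately have "K\<^bsub>1,3\<^esub> ?H"
      unfolding complete_bipartite_digraph_def using d
      by (intro conjI, simp) (rule exI[of _ "{c}"], rule exI[of _ "{u, v, w}"], auto)
    with ind show "\<exists>H. induced_subgraph H (with_proj G) \<and> K\<^bsub>1,3\<^esub> H" by blast
  qed
  then show ?thesis by (simp add: claw_free_def)
qed

section \<open>Adjacency in the reduced power graph\<close>

lemma reduced_power_graph_arc_iff: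
  "(u, v) \<in> parcs (reduced_power_graph G) \<longleftrightarrow> u \<in> carrier G \<and> v \<in> carrier G \<and>
     (generate G {v} \<subset> generate G {u} \<or> generate G {u} \<subset> generate G {v})"
  by (simp add: reduced_power_graph_def)

lemma pair_graph_reduced_power_graph:
  assumes "finite (carrier G)"
  shows "pair_graph (reduced_power_graph G)"
proof -
  interpret graph "with_proj (reduced_power_graph G)"
    using assms by (rule reduced_power_graph_graph)
  show ?thesis
    using finite_arcs finite_verts sym_arcs wellformed no_loops by unfold_locales simp_all
qed

context group
begin

lemma generate_singleton_subset:
  assumes "x \<in> carrier G" "y \<in> generate G {x}"
  shows "generate G {y} \<subseteq> generate G {x}"
  using assms by (intro generate_subgroup_incl generate_is_subgroup) auto

lemma ord_dvd_if_generate_subset: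
  assumes "x \<in> carrier G" "y \<in> carrier G" "generate G {x} \<subseteq> generate G {y}"
  shows "ord x dvd ord y"
proof -
  have "x \<in> generate G {y}" using assms(3) generate.incl[of x "{x}" G] by auto
  then obtain k :: int where "x = y [^] k" using generate_pow[OF assms(2)] by auto
  then have "x [^] ord y = \<one>"
    using assms(2) by (metis int_pow_eq_id int_pow_int int_pow_pow dvd_triv_right)
  then show ?thesis using assms(1) by (simp add: pow_eq_id)
qed

lemma ord_less_if_generate_psubset:
  assumes "finite (carrier G)" "x \<in> carrier G" "y \<in> carrier G" "generate G {x} \<subset> generate G {y}"
  shows "ord x < ord y"
proof -
  have "finite (generate G {y})"
    using generate_incl[of "{y}"] assms(1,3) by (auto intro: finite_subset)
  then show ?thesis
    using assms(2-4) by (simp add: generate_pow_card psubset_card_mono)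
qed

lemma not_adjacent_if_ord_eq:
  assumes "finite (carrier G)" "ord x = ord y"
  shows "(x, y) \<notin> parcs (reduced_power_graph G)"
  using assms ord_less_if_generate_psubset[of x y] ord_less_if_generate_psubset[of y x]
  by (auto simp: reduced_power_graph_arc_iff)

lemma not_adjacent_if_ord_incomparable:
  assumes "\<not> ord x dvd ord y" "\<not> ord y dvd ord x"
  shows "(x, y) \<notin> parcs (reduced_power_graph G)"
  using assms ord_dvd_if_generate_subset[of x y] ord_dvd_if_generate_subset[of y x]
  by (auto simp: reduced_power_graph_arc_iff)

lemma one_adjacent:
  assumes "x \<in> carrier G" "x \<noteq> \<one>"
  shows "(\<one>, x) \<in> parcs (reduced_power_graph G)"
proof -
  have "generate G {\<one>} = {\<one>}"
    by (simp add: generate_one)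
  moreover have "{\<one>} \<subset> generate G {x}"
    using assms generate.one[of G "{x}"] generate.incl[of x "{x}" G] by auto
  ultimately show ?thesis using assms by (simp add: reduced_power_graph_arc_iff)
qed

text \<open>The claw is centred at the identity.\<close>

lemma independent_triple_imp_not_claw_free:
  assumes "finite (carrier G)"
    and "u \<in> carrier G" "v \<in> carrier G" "w \<in> carrier G"
    and "u \<noteq> \<one>" "v \<noteq> \<one>" "w \<noteq> \<one>" "u \<noteq> v" "u \<noteq> w" "v \<noteq> w"
    and "(u, v) \<notin> parcs (reduced_power_graph G)" "(u, w) \<notin> parcs (reduced_power_graph G)"
      "(v, w) \<notin> parcs (reduced_power_graph G)"
  shows "\<not> claw_free (with_proj (reduced_power_graph G))"
  unfolding pair_graph.claw_free_iff[OF pair_graph_reduced_power_graph[OF assms(1)]] not_not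
  using assms one_adjacent[of u] one_adjacent[of v] one_adjacent[of w]
  by - (rule exI[of _ \<one>], rule exI[of _ u], rule exI[of _ v], rule exI[of _ w], simp)

section \<open>Independent triples\<close>

lemma pow_eq_iff_of_less_ord:
  assumes "x \<in> carrier G" "i < ord x" "j < ord x"
  shows "x [^] i = x [^] j \<longleftrightarrow> i = j"
proof -
  have "inj_on (\<lambda>k. x [^] k) {0..ord x - 1}"
    using assms(1) by (rule ord_inj)
  then show ?thesis using assms(2,3) by (auto dest!: inj_onD)
qed

lemma not_claw_free_if_ord_ge_5:
  assumes fin: "finite (carrier G)" and x: "x \<in> carrier G" and ge: "5 \<le> ord x"
  shows "\<not> claw_free (with_proj (reduced_power_graph G))"
proof -
  define m where "m = ord x"
  have m: "m \<ge> 5" "ord x = m" using ge by (auto simp: m_def)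
  have ordp: "ord (x [^] k) = m div gcd m k" if "k \<noteq> 0" for k :: nat
    using ord_pow_gen[OF x, of k] that m by simp
  have "coprime m (m - 1)"
    using m by (intro coprime_diff_one_right_nat) simp
  then have gcd_pred: "gcd m (m - 1) = 1"
    by (rule coprime_imp_gcd_eq_1)
  have claw: ?thesis
    if "0 < i" "0 < j" "0 < k" "i < m" "j < m" "k < m" "i \<noteq> j" "i \<noteq> k" "j \<noteq> k"
      and "(x [^] i, x [^] j) \<notin> parcs (reduced_power_graph G)"
        "(x [^] i, x [^] k) \<notin> parcs (reduced_power_graph G)"
        "(x [^] j, x [^] k) \<notin> parcs (reduced_power_graph G)"
    for i j k :: nat
    using that m x pow_eq_iff_of_less_ord[OF x] pow_eq_iff_of_less_ord[OF x, of _ 0]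
    by (intro independent_triple_imp_not_claw_free[OF fin, of "x [^] i" "x [^] j" "x [^] k"]) auto
  consider "odd m" | h where "m = 2 * h" "even h" | h where "m = 2 * h" "odd h"
    by (metis evenE)
  then show ?thesis
  proof cases
    case 1
    \<comment> \<open>\<open>x\<close>, \<open>x\<^sup>2\<close> and \<open>x\<inverse>\<close> all generate \<open>\<langle>x\<rangle>\<close>.\<close>
    have "gcd m 2 = 1"
      using 1 by (auto intro: coprime_imp_gcd_eq_1)
    then show ?thesis
      using m by (intro claw[of 1 2 "m - 1"] not_adjacent_if_ord_eq fin)
         (auto simp: ordp gcd_pred simp del: One_nat_def)
  next
    case 2
    \<comment> \<open>Here \<open>h \<ge> 4\<close>, and \<open>h + 1\<close> is odd and coprime to \<open>h\<close>, so \<open>x\<close>, \<open>x\<^sup>h\<^sup>+\<^sup>1\<close> and \<open>x\<inverse>\<close> all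
      generate \<open>\<langle>x\<rangle>\<close>.\<close>
    have "coprime (2 * h) (h + 1)"
      using 2 by (simp add: coprime_mult_left_iff)
    then have "gcd m (h + 1) = 1"
      unfolding 2 by (rule coprime_imp_gcd_eq_1)
    then show ?thesis
      using m 2 gcd_pred by (intro claw[of 1 "h + 1" "m - 1"] not_adjacent_if_ord_eq fin)
         (auto simp: ordp simp del: One_nat_def)
  next
    case 3
    \<comment> \<open>Here \<open>h \<ge> 3\<close>; the elements \<open>x\<^sup>2\<close> and \<open>x\<^sup>-\<^sup>2\<close> have odd order \<open>h\<close> and \<open>x\<^sup>h\<close> is an involution.\<close>
    have h: "h \<ge> 3" using m 3 by simp
    have "coprime h (h - 1)" using h by (intro coprime_diff_one_right_nat) simp
    then have "gcd m (2 * (h - 1)) = 2"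
      unfolding 3 by (simp add: gcd_mult_distrib_nat[symmetric])
    moreover have "gcd m 2 = 2" "gcd m h = h" using 3 by auto
    ultimately have o: "ord (x [^] (2::nat)) = h" "ord (x [^] (2 * (h - 1))) = h"
      "ord (x [^] h) = 2"
      using h 3 by (auto simp: ordp)
    have "\<not> h dvd 2" using h by (auto dest: dvd_imp_le)
    moreover have "\<not> 2 dvd h" using 3 by simp
    ultimately have "(x [^] (2::nat), x [^] h) \<notin> parcs (reduced_power_graph G)"
      "(x [^] (2 * (h - 1)), x [^] h) \<notin> parcs (reduced_power_graph G)"
      using o by (simp_all add: not_adjacent_if_ord_incomparable)
    moreover have "(x [^] (2::nat), x [^] (2 * (h - 1))) \<notin> parcs (reduced_power_graph G)"
      using o by (intro not_adjacent_if_ord_eq fin) simp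
    moreover have "0 < h - 1" "2 * (h - 1) < m" "2 \<noteq> 2 * (h - 1)" "2 \<noteq> h" "2 * (h - 1) \<noteq> h"
      using h 3 by auto
    ultimately show ?thesis
      using h 3 by (intro claw[of 2 "2 * (h - 1)" h]) auto
  qed
qed

lemma not_adjacent_if_notin_generate:
  assumes "finite (carrier G)" "y \<notin> generate G {x}" "ord y \<le> ord x"
  shows "(x, y) \<notin> parcs (reduced_power_graph G)"
  using assms ord_less_if_generate_psubset[of x y] generate.incl[of y "{y}" G]
  by (auto simp: reduced_power_graph_arc_iff)

lemma outside_maximal_imp_not_claw_free:
  assumes fin: "finite (carrier G)" and x: "x \<in> carrier G" and y: "y \<in> carrier G"
    and x1: "x \<noteq> \<one>" and max: "\<And>z. z \<in> carrier G \<Longrightarrow> ord z \<le> ord x"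
    and out: "y \<notin> generate G {x}"
  shows "\<not> claw_free (with_proj (reduced_power_graph G))"
proof (cases "inv x = x")
  case False
  have inv_in: "inv x \<in> generate G {x}" using generate.inv[of x "{x}" G] by simp
  then have "y \<notin> generate G {inv x}"
    using out generate_singleton_subset[OF x] by auto
  moreover have "y \<noteq> \<one>" "y \<noteq> x" "y \<noteq> inv x"
    using out inv_in generate.one[of G "{x}"] generate.incl[of x "{x}" G] by auto
  ultimately show ?thesis
    using fin x y x1 max[OF y] out False
    by (intro independent_triple_imp_not_claw_free[of x "inv x" y]
        not_adjacent_if_ord_eq not_adjacent_if_notin_generate) auto
next
  case True
  \<comment> \<open>By maximality of \<open>ord x = 2\<close>, all non-identity elements are involutions.\<close>
  then have "x [^] (2::nat) = \<one>"
    using x r_inv[OF x] by (simp add: numeral_2_eq_2)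
  then have "ord x dvd 2" using x by (simp add: pow_eq_id)
  then have "ord x \<le> 2" by (simp add: dvd_imp_le)
  then have ord2: "ord z = 2" if "z \<in> carrier G" "z \<noteq> \<one>" for z
    using that max[of z] ord_ge_1[OF fin, of z] ord_eq_1[of z] by linarith
  have "y \<noteq> \<one>" "y \<noteq> x"
    using out generate.one[of G "{x}"] generate.incl[of x "{x}" G] by auto
  moreover have "x \<otimes> y \<noteq> \<one>"
    using x y True \<open>y \<noteq> x\<close> by (metis inv_equality inv_inv)
  moreover have "x \<otimes> y \<noteq> x" "x \<otimes> y \<noteq> y"
    using x y x1 \<open>y \<noteq> \<one>\<close> by auto
  ultimately show ?thesis
    using fin x y x1
    by (intro independent_triple_imp_not_claw_free[of x y "x \<otimes> y"] not_adjacent_if_ord_eq)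
       (auto simp: ord2)
qed

section \<open>Finite cyclic groups\<close>

lemma iso_integer_mod_group_if_ord_eq_order:
  assumes fin: "finite (carrier G)" and x: "x \<in> carrier G" and ord: "ord x = order G"
  shows "G \<cong> integer_mod_group (order G)"
proof -
  define n where "n = order G"
  have n: "n > 0" "ord x = n"
    using fin ord by (auto simp: n_def order_gt_0_iff_finite)
  let ?h = "\<lambda>k::int. x [^] k"
  have hom: "?h \<in> hom (integer_mod_group n) G"
  proof (rule homI)
    fix i j :: int
    have "?h ((i + j) mod int n) = ?h (i + j)"
      using x n by (simp add: int_pow_eq mod_eq_dvd_iff[symmetric])
    then show "?h (i \<otimes>\<^bsub>integer_mod_group n\<^esub> j) = ?h i \<otimes> ?h j"
      using x by (simp add: int_pow_mult)
  qed (use x in simp)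
  have inj: "inj_on ?h (carrier (integer_mod_group n))"
  proof (rule inj_onI)
    fix i j assume ij: "i \<in> carrier (integer_mod_group n)" "j \<in> carrier (integer_mod_group n)"
      and "?h i = ?h j"
    then have "int n dvd j - i" using x n by (simp add: int_pow_eq)
    then have "j mod int n = i mod int n" by (simp add: mod_eq_dvd_iff)
    with ij n show "i = j" by (simp add: carrier_integer_mod_group)
  qed
  have "?h ` carrier (integer_mod_group n) = carrier G"
  proof (rule card_subset_eq[OF fin])
    show "card (?h ` carrier (integer_mod_group n)) = card (carrier G)"
      using n by (simp add: card_image[OF inj]) (simp add: carrier_integer_mod_group n_def order_def)
  qed (use x in auto)
  then have "?h \<in> iso (integer_mod_group n) G"
    using hom inj by (simp add: iso_def bij_betw_def)
  then have "integer_mod_group n \<cong> G" by (rule is_isoI)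
  then show ?thesis unfolding n_def by (rule group.iso_sym[OF group_integer_mod_group])
qed

lemma exists_ord_eq_order_if_iso_integer_mod_group:
  assumes "G \<cong> integer_mod_group n"
  shows "\<exists>x\<in>carrier G. ord x = order G"
proof -
  interpret Z: group "integer_mod_group n" by simp
  have "cyclic_group (integer_mod_group n)"
  proof (cases "n = 1")
    case True
    then show ?thesis by (simp add: trivial_imp_cyclic_group trivial_integer_mod_group)
  next
    case False
    have "carrier (integer_mod_group n) = range (\<lambda>k::int. 1 [^]\<^bsub>integer_mod_group n\<^esub> k)"
      by (auto simp: int_pow_integer_mod_group carrier_integer_mod_group image_iff)
         (metis mod_pos_pos_trivial)
    then show ?thesis using False Z.cyclic_group by (metis integer_mod_group_1)
  qed
  then have "cyclic_group G"
    using assms isomorphic_group_cyclicity[OF assms] by simp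
  then obtain x where "x \<in> carrier G" "subgroup_generated G {x} = G"
    unfolding cyclic_group_def by blast
  then show ?thesis using cyclic_order_is_ord[of x] by auto
qed

text \<open>
  In the cyclic group of order 4 the square of a generator is adjacent to all other vertices, as
  the identity is.
\<close>

lemma square_adjacent_in_cyclic_order_4:
  assumes x: "x \<in> carrier G" and ord: "ord x = 4" and card: "order G = 4"
    and y: "y \<in> carrier G" "y \<noteq> x [^] (2::nat)"
  shows "(x [^] (2::nat), y) \<in> parcs (reduced_power_graph G)"
proof -
  have fin: "finite (carrier G)" using card by (simp add: order_gt_0_iff_finite[symmetric])
  have ord_sq: "ord (x [^] (2::nat)) = 2" using x ord by (simp add: ord_pow)
  have full: "generate G {z} = carrier G" if "z \<in> carrier G" "ord z = 4" for z
    using that card generate_incl[of "{z}"] generate_pow_card[of z]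
    by (intro card_subset_eq[OF fin]) (auto simp: order_def)
  have "y \<in> generate G {x}" using full[OF x ord] y by simp
  then obtain k :: nat where "k \<in> {0..4 - 1}" and yk: "y = x [^] k"
    unfolding generate_pow_on_finite_carrier[OF fin x] ord_elems[OF fin x] ord by blast
  then have k: "k < 4" "y = x [^] k" by auto
  show ?thesis
  proof (cases "y = \<one>")
    case True
    have "x [^] (2::nat) \<noteq> \<one>" using y True by simp
    then have "(\<one>, x [^] (2::nat)) \<in> parcs (reduced_power_graph G)"
      using x by (intro one_adjacent) auto
    then show ?thesis
      unfolding True by (auto simp: reduced_power_graph_arc_iff)
  next
    case False
    then have "k \<noteq> 0" "k \<noteq> 2" using y k by (metis nat_pow_0, metis)
    then have "k = 1 \<or> k = 3" using k by linarith
    moreover have "gcd 4 (3::nat) = 1" by (simp add: gcd_non_0_nat)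
    ultimately have "ord y = 4" using x ord k ord_pow_gen[OF x, of k] by auto
    then have "generate G {y} = carrier G" using y full by simp
    moreover have "generate G {x [^] (2::nat)} \<noteq> carrier G"
      using x card ord_sq generate_pow_card[of "x [^] (2::nat)"] by (auto simp: order_def)
    ultimately show ?thesis
      using x y generate_incl[of "{x [^] (2::nat)}"] by (auto simp: reduced_power_graph_arc_iff)
  qed
qed

lemma claw_free_if_cyclic_of_small_order:
  assumes x: "x \<in> carrier G" "ord x = order G" and card: "order G \<in> {2, 3, 4}"
  shows "claw_free (with_proj (reduced_power_graph G))"
proof -
  have fin: "finite (carrier G)" using card by (auto simp: order_gt_0_iff_finite[symmetric])
  interpret P: pair_graph "reduced_power_graph G"
    using fin by (rule pair_graph_reduced_power_graph)
  show ?thesis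
    unfolding P.claw_free_iff
  proof
    assume "\<exists>c u v w. u \<noteq> v \<and> u \<noteq> w \<and> v \<noteq> w \<and>
        {(c, u), (c, v), (c, w)} \<subseteq> parcs (reduced_power_graph G) \<and>
        (u, v) \<notin> parcs (reduced_power_graph G) \<and> (u, w) \<notin> parcs (reduced_power_graph G) \<and>
        (v, w) \<notin> parcs (reduced_power_graph G)"
    then obtain c u v w where d: "u \<noteq> v" "u \<noteq> w" "v \<noteq> w"
      and e: "(c, u) \<in> parcs (reduced_power_graph G)" "(c, v) \<in> parcs (reduced_power_graph G)"
        "(c, w) \<in> parcs (reduced_power_graph G)"
      and n: "(u, v) \<notin> parcs (reduced_power_graph G)" "(u, w) \<notin> parcs (reduced_power_graph G)"
        "(v, w) \<notin> parcs (reduced_power_graph G)"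
      by auto
    have ne: "c \<noteq> u" "c \<noteq> v" "c \<noteq> w" and mem: "{c, u, v, w} \<subseteq> carrier G"
      using e by (auto simp: reduced_power_graph_arc_iff)
    have sym: "(b, a) \<in> parcs (reduced_power_graph G)" if "(a, b) \<in> parcs (reduced_power_graph G)"
      for a b using that by (auto simp: reduced_power_graph_arc_iff)
    have card4: "card {c, u, v, w} = 4" using ne d by auto
    then have "4 \<le> order G" using card_mono[OF fin mem] by (simp add: order_def)
    then have o4: "order G = 4" using card by auto
    then have all: "carrier G = {c, u, v, w}"
      using card_subset_eq[OF fin mem] card4 by (simp add: order_def)
    \<comment> \<open>A leaf misses another leaf, so neither universal vertex is a leaf; both would be the centre.\<close>
    have centre: "z = c"
      if "z \<in> carrier G"
        and "\<And>y. y \<in> carrier G \<Longrightarrow> y \<noteq> z \<Longrightarrow> (z, y) \<in> parcs (reduced_power_graph G)" for z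
      using that d n sym unfolding all by blast
    have "\<one> = c" by (rule centre) (auto intro: one_adjacent)
    moreover have "x [^] (2::nat) = c"
      using x o4 by (intro centre square_adjacent_in_cyclic_order_4) auto
    ultimately have "x [^] (2::nat) = \<one>" by simp
    then have "4 dvd (2::nat)" using x o4 by (simp add: pow_eq_id)
    then show False by simp
  qed
qed

lemma cyclic_of_small_order_if_claw_free:
  assumes fin: "finite (carrier G)" and nontriv: "\<not> trivial_group G"
    and cf: "claw_free (with_proj (reduced_power_graph G))"
  shows "\<exists>x\<in>carrier G. ord x = order G \<and> order G \<in> {2, 3, 4}"
proof -
  obtain a where a: "a \<in> carrier G" "a \<noteq> \<one>"
    using nontriv is_group one_closed unfolding trivial_group_def by blast
  have "Max (ord ` carrier G) \<in> ord ` carrier G"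
    using fin one_closed by (intro Max_in) auto
  then obtain x where x: "x \<in> carrier G" "ord x = Max (ord ` carrier G)" by auto
  have max: "ord z \<le> ord x" if "z \<in> carrier G" for z
    using that fin x(2) by simp
  have "ord a \<ge> 2" using a ord_ge_1[OF fin, of a] ord_eq_1[of a] by linarith
  then have ge2: "ord x \<ge> 2" using max[of a] a by simp
  then have x1: "x \<noteq> \<one>" by auto
  have "carrier G \<subseteq> generate G {x}"
    using outside_maximal_imp_not_claw_free[OF fin x(1) _ x1 max] cf by blast
  then have "generate G {x} = carrier G"
    using generate_incl[of "{x}"] x(1) by blast
  then have "ord x = order G" using generate_pow_card[OF x(1)] by (simp add: order_def)
  moreover have "ord x < 5" using not_claw_free_if_ord_ge_5[OF fin x(1)] cf by linarith
  ultimately show ?thesis using x ge2 by (intro bexI[of _ x]) auto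
qed

end

theorem theorem3p2:
  fixes G :: "('a, 'b) monoid_scheme"
  assumes "group G" and "finite (carrier G)" and "\<not> trivial_group G"
  shows "claw_free (with_proj (reduced_power_graph G)) \<longleftrightarrow>
           (\<exists>n\<in>{2, 3, 4}. G \<cong> integer_mod_group n)"
proof -
  interpret group G by fact
  show ?thesis
  proof
    assume "claw_free (with_proj (reduced_power_graph G))"
    then obtain x where "x \<in> carrier G" "ord x = order G" "order G \<in> {2, 3, 4}"
      using cyclic_of_small_order_if_claw_free assms by blast
    then show "\<exists>n\<in>{2, 3, 4}. G \<cong> integer_mod_group n"
      using iso_integer_mod_group_if_ord_eq_order[OF assms(2)] by blast
  next
    assume "\<exists>n\<in>{2, 3, 4}. G \<cong> integer_mod_group n"
    then obtain n where n: "n \<in> {2, 3, 4}" and iso: "G \<cong> integer_mod_group n" by blast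
    have "order G = n"
      using iso_same_card[OF iso] n by (auto simp: order_def carrier_integer_mod_group)
    then show "claw_free (with_proj (reduced_power_graph G))"
      using exists_ord_eq_order_if_iso_integer_mod_group[OF iso] n
      by (auto intro: claw_free_if_cyclic_of_small_order)
  qed
qed

end
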